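(* Let $n\ge 1$ and $m\ge 0$ be integers and let $f:\mathbb{R}^n\to\mathbb{R}$ satisfy the Fréchet functional equation $$\Delta_h^{m+1}f(x)=0\quad\text{for all }x,h\in\mathbb{R}^n,$$ and suppose that $f(x_1,\dots,x_n)$ is not an ordinary polynomial. Then $f$ is not bounded on any nonempty open subset of $\mathbb{R}^n$. Moreover, $\overline{G(f)}^{\mathbb{R}^{n+1}}$ contains an unbounded open set (open in $\mathbb{R}^{n+1}$).
   Context: For $f:\mathbb{R}^n\to\mathbb{R}$ and $x,h\in\mathbb{R}^n$, $\Delta_h f(x)=f(x+h)-f(x)$, and $\Delta_h^{s}$ is the $s$-fold iterate of $\Delta_h$, so that $\Delta_h^{m+1}f(x)=\sum_{k=0}^{m+1}\binom{m+1}{k}(-1)^{m+1-k}f(x+kh)$. $G(f)=\{(x,f(x)):x\in\mathbb{R}^n\}\subseteq\mathbb{R}^{n+1}$ is the graph of $f$ and $\overline{G(f)}^{\mathbb{R}^{n+1}}$ its topological closure in $\mathbb{R}^{n+1}$. An ordinary polynomial is a function given by a polynomial in $x_1,\dots,x_n$ with real coefficients. *)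

theory Defs
  imports "HOL-Analysis.Analysis"
begin

definition forward_diff :: "'a::real_vector \<Rightarrow> ('a \<Rightarrow> real) \<Rightarrow> ('a \<Rightarrow> real)"
  where "forward_diff h f = (\<lambda>x. f (x + h) - f x)"

definition function_graph :: "('a \<Rightarrow> real) \<Rightarrow> ('a \<times> real) set"
  where "function_graph f = {(x, f x) | x. True}"

(* A ranges over finite sets of multi-indices, c assigns the coefficients. *)
definition ordinary_polynomial :: "(real ^ 'n \<Rightarrow> real) \<Rightarrow> bool"
  where "ordinary_polynomial f \<longleftrightarrow>
    (\<exists>(A :: ('n \<Rightarrow> nat) set) c. finite A \<and>
       (\<forall>x. f x = (\<Sum>\<alpha>\<in>A. c \<alpha> * (\<Prod>i\<in>UNIV. (x $ i) ^ \<alpha> i))))"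

lemma ordinary_polynomialI:
  fixes f :: "real ^ 'n \<Rightarrow> real" and e :: "'i \<Rightarrow> 'n \<Rightarrow> nat"
  assumes fin: "finite I"
    and f: "\<And>x. f x = (\<Sum>k\<in>I. d k * (\<Prod>i\<in>UNIV. (x $ i) ^ e k i))"
  shows "ordinary_polynomial f"
proof -
  define c where "c \<alpha> = (\<Sum>k | k \<in> I \<and> e k = \<alpha>. d k)" for \<alpha>
  have "f x = (\<Sum>\<alpha>\<in>e ` I. c \<alpha> * (\<Prod>i\<in>UNIV. (x $ i) ^ \<alpha> i))" for x
  proof -
    have "f x = (\<Sum>\<alpha>\<in>e ` I. \<Sum>k | k \<in> I \<and> e k = \<alpha>. d k * (\<Prod>i\<in>UNIV. (x $ i) ^ e k i))"
      unfolding f by (rule sum.image_gen[OF fin])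
    also have "\<dots> = (\<Sum>\<alpha>\<in>e ` I. c \<alpha> * (\<Prod>i\<in>UNIV. (x $ i) ^ \<alpha> i))"
      unfolding c_def sum_distrib_right by (intro sum.cong refl) auto
    finally show ?thesis .
  qed
  with fin show ?thesis
    unfolding ordinary_polynomial_def by blast
qed

lemma ordinary_polynomial_iff_real_polynomial_function:
  fixes f :: "real ^ 'n \<Rightarrow> real"
  shows "ordinary_polynomial f \<longleftrightarrow> real_polynomial_function f"
proof
  assume "ordinary_polynomial f"
  then obtain A :: "('n \<Rightarrow> nat) set" and c where "finite A"
    and f: "f = (\<lambda>x. \<Sum>\<alpha>\<in>A. c \<alpha> * (\<Prod>i\<in>UNIV. (x $ i) ^ \<alpha> i))"
    unfolding ordinary_polynomial_def by blast
  have "real_polynomial_function (\<lambda>x :: real ^ 'n. \<Prod>i\<in>S. (x $ i) ^ \<alpha> i)"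
    if "finite S" for S and \<alpha> :: "'n \<Rightarrow> nat"
    using that
    by (induction S rule: finite_induct)
      (auto intro!: real_polynomial_function_power bounded_linear_vec_nth)
  with \<open>finite A\<close> show "real_polynomial_function f"
    unfolding f by (intro real_polynomial_function_sum) auto
next
  assume "real_polynomial_function f"
  then show "ordinary_polynomial f"
  proof (induction f rule: real_polynomial_function.induct)
    case (linear f)
    show ?case
    proof (rule ordinary_polynomialI)
      fix x :: "real ^ 'n"
      have "f x = f (\<Sum>i\<in>UNIV. (x $ i) *\<^sub>R axis i 1)"
        using basis_expansion[of x] by (simp add: scalar_mult_eq_scaleR)
      also have "\<dots> = (\<Sum>k\<in>UNIV. f (axis k 1) * x $ k)"
        using bounded_linear.linear[OF linear] by (simp add: linear_sum linear_cmul mult.commute)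
      also have "\<dots> = (\<Sum>k\<in>UNIV. f (axis k 1) * (\<Prod>i\<in>UNIV. (x $ i) ^ (if i = k then 1 else 0)))"
        by (simp add: if_distrib[of "\<lambda>n. _ ^ n"] cong: if_cong)
      finally show "f x = \<dots>" .
    qed simp
  next
    case (const c)
    show ?case
      by (rule ordinary_polynomialI[where I = "{()}" and d = "\<lambda>_. c" and e = "\<lambda>_ _. 0"]) auto
  next
    case (add f g)
    then obtain A B :: "('n \<Rightarrow> nat) set" and c d where "finite A" "finite B"
      and "\<And>x. f x = (\<Sum>\<alpha>\<in>A. c \<alpha> * (\<Prod>i\<in>UNIV. (x $ i) ^ \<alpha> i))"
      and "\<And>x. g x = (\<Sum>\<alpha>\<in>B. d \<alpha> * (\<Prod>i\<in>UNIV. (x $ i) ^ \<alpha> i))"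
      unfolding ordinary_polynomial_def by blast
    then show ?case
      by (intro ordinary_polynomialI[where I = "A <+> B" and d = "case_sum c d" and e = "case_sum id id"])
        (auto simp: sum.Plus)
  next
    case (mult f g)
    then obtain A B :: "('n \<Rightarrow> nat) set" and c d where "finite A" "finite B"
      and "\<And>x. f x = (\<Sum>\<alpha>\<in>A. c \<alpha> * (\<Prod>i\<in>UNIV. (x $ i) ^ \<alpha> i))"
      and "\<And>x. g x = (\<Sum>\<alpha>\<in>B. d \<alpha> * (\<Prod>i\<in>UNIV. (x $ i) ^ \<alpha> i))"
      unfolding ordinary_polynomial_def by blast
    then show ?case
      by (intro ordinary_polynomialI[where I = "A \<times> B" and d = "\<lambda>(\<alpha>, \<beta>). c \<alpha> * d \<beta>"
            and e = "\<lambda>(\<alpha>, \<beta>) i. \<alpha> i + \<beta> i"])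
        (auto simp: sum_product sum.cartesian_product power_add prod.distrib mult_ac intro!: sum.cong)
  qed
qed

end

theory Submission
  imports Defs
begin

text \<open>
  At the points with rational coordinates every solution of the Frechet equation is
  a polynomial: along a single line Newton's forward difference formula shows this with the
  explicit coefficients \<open>\<Delta>\<^sub>h\<^sup>k f(x)\<close>, and these are again solutions, so that one can treat
  one coordinate after the other. Hence for every linear map \<open>L\<close> from a Euclidean space the
  composition \<open>f \<circ> L\<close> agrees with a polynomial at all points with rational coordinates
  (\<open>frechet_linear_polynomial\<close>).

  For \<open>L = id\<close> this yields a polynomial \<open>Q\<close>. If \<open>f\<close> is not a polynomial, then
  \<open>f h \<noteq> Q h\<close> for some \<open>h\<close>. Apply the same to \<open>L (t, s) = t + s h\<close>, obtaining a polynomial \<open>P\<close> in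
  one more variable. Rational points are dense, so the closure of the graph contains all points
  \<open>(t + s h, P (t, s))\<close>. In the coordinates \<open>x = t + s h\<close> and \<open>s\<close> this says: over every \<open>x\<close>, the
  closure of the graph contains the whole range of \<open>s \<mapsto> g (x, s) = P (x - s h, s)\<close>. This
  polynomial really depends on \<open>s\<close>, because over \<open>h\<close> it takes the value \<open>Q h\<close> at \<open>s = 0\<close> and
  \<open>f h\<close> at \<open>s = 1\<close> (\<open>frechet_closure_family\<close>).

  Both claims follow. If \<open>f\<close> were bounded on an open set, then over that set the polynomials
  \<open>s \<mapsto> g (x, s)\<close> would be bounded, hence constant, and \<open>g (x, 1) - g (x, 0)\<close> would vanish
  on an open set, hence everywhere. The open unbounded set consists of the points \<open>(x, y)\<close> with
  \<open>y\<close> strictly between two values of \<open>g (x, \<cdot>)\<close>: it lies in the closure by the intermediate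
  value theorem, and it is unbounded since a nonconstant polynomial is.
\<close>

section \<open>Newton's formula at rational points\<close>

lemma forward_diff_commute: "forward_diff h (forward_diff k f) = forward_diff k (forward_diff h f)"
  by (auto simp: forward_diff_def algebra_simps)

lemma funpow_forward_diff_frechet:
  assumes "\<And>x h. (forward_diff h ^^ N) f x = 0"
  shows "(forward_diff h ^^ N) ((forward_diff b ^^ k) f) x = 0"
proof -
  have swap1: "forward_diff b ((forward_diff h ^^ i) g) = (forward_diff h ^^ i) (forward_diff b g)" for i g
    by (induction i) (simp_all add: forward_diff_commute[of b h])
  have swap: "(forward_diff h ^^ N) ((forward_diff b ^^ k) f) = (forward_diff b ^^ k) ((forward_diff h ^^ N) f)"
    by (induction k) (simp_all flip: swap1)
  have "(forward_diff h ^^ N) f = (\<lambda>_. 0)"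
    using assms by auto
  moreover have "(forward_diff b ^^ k) (\<lambda>_. 0) = (\<lambda>_. 0)"
    by (induction k) (auto simp: forward_diff_def)
  ultimately show ?thesis
    by (simp add: swap)
qed

lemma newton_forward_nat:
  assumes "\<And>x. (forward_diff h ^^ Suc m) f x = 0"
  shows "f (x + real i *\<^sub>R h) = (\<Sum>k\<le>m. real (i choose k) * (forward_diff h ^^ k) f x)"
  using assms
proof (induction m arbitrary: f i)
  case 0
  then have "f (y + h) = f y" for y
    by (simp add: forward_diff_def)
  then have "f (x + real i *\<^sub>R h) = f x"
    by (induction i) (simp_all add: algebra_simps, metis add.assoc add.commute)
  then show ?case
    by simp
next
  case (Suc m)
  define c where "c k = (forward_diff h ^^ Suc k) f x" for k
  have IH: "forward_diff h f (x + real i *\<^sub>R h) = (\<Sum>k\<le>m. real (i choose k) * c k)" for i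
    using Suc.IH[of "forward_diff h f" i] Suc.prems
    by (simp add: c_def funpow_swap1)
  have "f (x + real i *\<^sub>R h) = f x + (\<Sum>k\<le>m. real (i choose Suc k) * c k)"
  proof (induction i)
    case (Suc i)
    have "f (x + real (Suc i) *\<^sub>R h) = f (x + real i *\<^sub>R h) + forward_diff h f (x + real i *\<^sub>R h)"
      by (simp add: forward_diff_def algebra_simps)
    then show ?case
      by (simp only: Suc IH) (simp add: sum.distrib algebra_simps)
  qed simp
  then show ?case
    by (simp add: sum.atMost_Suc_shift c_def del: sum.atMost_Suc funpow.simps(2))
qed

text \<open>The generalized binomial coefficient is packaged as an object of type \<open>poly\<close>, so that
  agreement of two polynomials at infinitely many points can be turned into an equation.\<close>

lemma real_gbinomial_poly: "\<exists>p :: real poly. \<forall>x. poly p x = x gchoose k"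
  by (rule exI[of _ "smult (1 / fact k) (\<Prod>i=0..<k. [:- real i, 1:])"])
    (simp add: gbinomial_prod_rev poly_prod)

text \<open>Suppose \<open>N q\<close> is an integer. Newton's formula with step \<open>h / N\<close>, started far enough to the
  left, expresses \<open>f\<close> on the grid \<open>x + (i / N) h\<close> by one polynomial. That grid contains \<open>x + q h\<close>
  and all \<open>x + j h\<close>, and on the latter the polynomial agrees with Newton's formula for step \<open>h\<close>;
  hence the two polynomials are equal.\<close>

lemma newton_forward_rat:
  assumes frechet: "\<And>x h. (forward_diff h ^^ Suc m) f x = 0" and "q \<in> \<rat>"
  shows "f (x + q *\<^sub>R h) = (\<Sum>k\<le>m. (q gchoose k) * (forward_diff h ^^ k) f x)"
proof -
  obtain G :: "nat \<Rightarrow> real poly" where G: "\<And>k x. poly (G k) x = x gchoose k"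
    using real_gbinomial_poly by metis
  have newton: "\<exists>p. \<forall>i. f (y + real i *\<^sub>R k) = poly p (real i)" for y k
    by (rule exI[of _ "\<Sum>j\<le>m. smult ((forward_diff k ^^ j) f y) (G j)"])
      (simp add: newton_forward_nat[OF frechet] poly_sum G binomial_gbinomial mult.commute)
  obtain a :: int and N :: nat where N: "N > 0" and q: "q = a / N"
    using Rats_cases'[OF \<open>q \<in> \<rat>\<close>] by (metis of_int_of_nat_eq zero_less_imp_eq_int)
  (* Newton's formula only reaches forward; M steps back make q accessible when it is negative. *)
  define M where "M = nat \<bar>a\<bar>"
  define y where "y = x - real M *\<^sub>R h"
  obtain p where p: "\<And>i. f (y + real i *\<^sub>R (h /\<^sub>R N)) = poly p (real i)"
    using newton by metis
  define p' where "p' = pcompose p [:real (M * N), real N:]"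
  define r where "r = (\<Sum>k\<le>m. smult ((forward_diff h ^^ k) f x) (G k))"
  have p': "f (x + s *\<^sub>R h) = poly p' s" if "real i = real (M * N) + real N * s" for s i
  proof -
    have "y + real i *\<^sub>R (h /\<^sub>R N) = x + s *\<^sub>R h"
      using N by (simp add: that y_def algebra_simps)
    then show ?thesis
      using p[of i] by (simp add: p'_def poly_pcompose that mult.commute)
  qed
  have "poly p' (real j) = poly r (real j)" for j
    using p'[of "M * N + N * j" "real j"]
    by (simp add: newton_forward_nat[OF frechet] r_def poly_sum G binomial_gbinomial mult.commute)
  then have "range real \<subseteq> {s. poly (p' - r) s = 0}"
    by auto
  then have "p' = r"
    using poly_roots_finite[of "p' - r"] finite_subset infinite_UNIV_char_0
    by (metis finite_imageD inj_of_nat right_minus_eq)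
  have "a + int (M * N) \<ge> 0"
  proof -
    have "int M * 1 \<le> int M * int N" using N by (intro mult_left_mono) auto
    then show ?thesis by (simp add: M_def)
  qed
  then have "real (nat (a + int (M * N))) = real (M * N) + real N * q"
    using N q by (simp add: of_nat_nat)
  from p'[OF this] show ?thesis
    by (simp add: \<open>p' = r\<close> r_def poly_sum G mult.commute)
qed

section \<open>Several variables\<close>

text \<open>The induction expands along one direction \<open>b a\<close> by Newton's formula. The coefficients are
  the iterated differences of \<open>f\<close> at the remaining sum; they are solutions of the same
  equation, which is why the induction is over all solutions \<open>f\<close>.\<close>

lemma frechet_sum_polynomial:
  fixes f :: "'a::real_vector \<Rightarrow> real" and c :: "'i \<Rightarrow> 'e::real_normed_vector \<Rightarrow> real"
  assumes "finite S" and c: "\<And>i. i \<in> S \<Longrightarrow> bounded_linear (c i)"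
    and "\<And>x h. (forward_diff h ^^ Suc m) f x = 0"
  shows "\<exists>P. real_polynomial_function P \<and>
    (\<forall>v. (\<forall>i\<in>S. c i v \<in> \<rat>) \<longrightarrow> f (x + (\<Sum>i\<in>S. c i v *\<^sub>R b i)) = P v)"
  using assms
proof (induction S arbitrary: f x rule: finite_induct)
  case empty
  then show ?case
    by (intro exI[of _ "\<lambda>_. f x"]) auto
next
  case (insert a S)
  have "\<exists>P. real_polynomial_function P \<and> (\<forall>v. (\<forall>i\<in>S. c i v \<in> \<rat>) \<longrightarrow>
      (forward_diff (b a) ^^ k) f (x + (\<Sum>i\<in>S. c i v *\<^sub>R b i)) = P v)" for k
    by (rule insert.IH) (use insert.prems funpow_forward_diff_frechet[OF insert.prems(2)] in auto)
  then obtain P where P: "\<And>k. real_polynomial_function (P k)" and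
    eq: "\<And>k v. (\<forall>i\<in>S. c i v \<in> \<rat>) \<Longrightarrow> (forward_diff (b a) ^^ k) f (x + (\<Sum>i\<in>S. c i v *\<^sub>R b i)) = P k v"
    by metis
  have "bounded_linear (c a)"
    using insert.prems(1) by auto
  then have "real_polynomial_function (\<lambda>v. c a v gchoose k)" for k
    unfolding gbinomial_prod_rev
    by (intro real_polynomial_function_divide real_polynomial_function_prod real_polynomial_function_diff
        real_polynomial_function.intros) auto
  then have "real_polynomial_function (\<lambda>v. \<Sum>k\<le>m. (c a v gchoose k) * P k v)"
    by (intro real_polynomial_function_sum real_polynomial_function.intros(4) P) auto
  moreover have "f (x + (\<Sum>i\<in>insert a S. c i v *\<^sub>R b i)) = (\<Sum>k\<le>m. (c a v gchoose k) * P k v)"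
    if "\<forall>i\<in>insert a S. c i v \<in> \<rat>" for v
  proof -
    have "f (x + (\<Sum>i\<in>insert a S. c i v *\<^sub>R b i)) = f ((x + (\<Sum>i\<in>S. c i v *\<^sub>R b i)) + c a v *\<^sub>R b a)"
      using insert.hyps by (simp add: algebra_simps)
    then show ?thesis
      using that by (simp add: newton_forward_rat[OF insert.prems(2)] eq del: funpow.simps)
  qed
  ultimately show ?case
    by blast
qed

definition rational_points :: "'e::euclidean_space set"
  where "rational_points = {v. \<forall>b\<in>Basis. v \<bullet> b \<in> \<rat>}"

lemma closure_rational_points: "closure rational_points = (UNIV :: 'e::euclidean_space set)"
proof -
  have "(\<Union>f\<in>Basis \<rightarrow> \<rat>. {\<Sum>i\<in>Basis. f i *\<^sub>R i}) \<subseteq> (rational_points :: 'e set)"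
    by (auto simp: rational_points_def)
  from closure_mono[OF this] show ?thesis
    using closure_rational_coordinates by auto
qed

lemma frechet_linear_polynomial:
  fixes f :: "'a::real_normed_vector \<Rightarrow> real" and L :: "'e::euclidean_space \<Rightarrow> 'a"
  assumes "\<And>x h. (forward_diff h ^^ Suc m) f x = 0" and L: "linear L"
  shows "\<exists>P. real_polynomial_function P \<and> (\<forall>v\<in>rational_points. f (L v) = P v)"
proof -
  have "(\<Sum>b\<in>Basis. (v \<bullet> b) *\<^sub>R L b) = L (\<Sum>b\<in>Basis. (v \<bullet> b) *\<^sub>R b)" for v
    by (simp only: linear_sum[OF L] linear_cmul[OF L])
  then have "(\<Sum>b\<in>Basis. (v \<bullet> b) *\<^sub>R L b) = L v" for v
    by (simp only: euclidean_representation)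
  then show ?thesis
    using frechet_sum_polynomial[where c = "\<lambda>b v. v \<bullet> b" and S = Basis and b = L and x = 0, OF _ _ assms(1)]
    by (simp add: rational_points_def bounded_linear_inner_left)
qed

section \<open>Polynomial functions\<close>

lemma real_polynomial_function_bounded_imp_const:
  fixes p :: "real \<Rightarrow> real"
  assumes "real_polynomial_function p" and "bounded (range p)"
  shows "p s = p t"
proof -
  obtain a n where p: "p = (\<lambda>x. \<Sum>i\<le>n. a i * x ^ i)"
    using assms(1) by (auto simp: real_polynomial_function_iff_sum)
  obtain B where B: "\<And>x. norm (p x) \<le> B"
    using assms(2) by (auto simp: bounded_iff)
  have "a k = 0" if "k \<noteq> 0" "k \<le> n" for k
  proof (rule ccontr)
    assume "a k \<noteq> 0"
    then have "eventually (\<lambda>z. norm (p z) \<ge> B + 1) at_infinity"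
      unfolding p using that by (intro polyfun_extremal) auto
    then have "eventually (\<lambda>z::real. False) at_infinity"
      by eventually_elim (use B in \<open>smt (verit)\<close>)
    then show False
      by (simp add: trivial_limit_at_infinity flip: trivial_limit_def)
  qed
  then have "p x = a 0" for x
    unfolding p by (subst sum.mono_neutral_right[of _ "{0}"]) auto
  then show ?thesis
    by simp
qed

lemma real_polynomial_function_compose':
  assumes "real_polynomial_function p" and "polynomial_function q"
  shows "real_polynomial_function (\<lambda>x. p (q x))"
  using real_polynomial_function_compose[OF assms(2,1)] by (simp add: o_def)

lemma polynomial_function_Pair:
  assumes "polynomial_function p" and "polynomial_function q"
  shows "polynomial_function (\<lambda>x. (p x, q x))"
proof -
  have "polynomial_function (\<lambda>x. (p x, 0) + (0, q x))"
    by (intro polynomial_function_add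
        polynomial_function_compose[where g = "\<lambda>y. (y, 0)", unfolded o_def, OF assms(1)]
        polynomial_function_compose[where g = "\<lambda>y. (0, y)", unfolded o_def, OF assms(2)]
        polynomial_function_bounded_linear bounded_linear_Pair bounded_linear_ident bounded_linear_zero)
  then show ?thesis
    by simp
qed

text \<open>Restricted to the line from a point of \<open>U\<close> to \<open>y\<close>, the polynomial has infinitely many
  zeros.\<close>

lemma real_polynomial_function_zero_on_open:
  fixes p :: "'a::euclidean_space \<Rightarrow> real"
  assumes p: "real_polynomial_function p" and "open U" "u \<in> U" and zero: "\<And>x. x \<in> U \<Longrightarrow> p x = 0"
  shows "p y = 0"
proof -
  define l where "l t = u + t *\<^sub>R (y - u)" for t :: real
  have "polynomial_function l"
    unfolding l_def by (intro polynomial_function_add polynomial_function_mult) auto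
  then have "real_polynomial_function (\<lambda>t. p (l t))"
    by (rule real_polynomial_function_compose'[OF p])
  then obtain a n where a: "\<And>t. p (l t) = (\<Sum>i\<le>n. a i * t ^ i)"
    unfolding real_polynomial_function_iff_sum by metis
  have "open (l -` U)"
    using \<open>open U\<close> unfolding l_def by (intro open_vimage continuous_intros)
  moreover have "0 \<in> l -` U"
    using \<open>u \<in> U\<close> by (simp add: l_def)
  ultimately have "infinite (l -` U)"
    using finite_imp_not_open by blast
  moreover have "l -` U \<subseteq> {t. (\<Sum>i\<le>n. a i * t ^ i) = 0}"
    using zero by (auto simp flip: a)
  ultimately have "\<not> (\<exists>k\<le>n. a k \<noteq> 0)"
    using polyfun_rootbound_finite finite_subset by metis
  then have "p (l 1) = 0"
    by (simp add: a)
  then show ?thesis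
    by (simp add: l_def)
qed

section \<open>The closure of the graph\<close>

text \<open>The function \<open>g\<close> is the polynomial for the map \<open>(t, s) \<mapsto> t + s h\<close>, sheared so that its first
  argument is the base point of the graph. The vector \<open>h\<close> is one where \<open>f\<close> differs from the
  polynomial that it equals on the rational points.\<close>

lemma frechet_closure_family:
  fixes f :: "real ^ 'n \<Rightarrow> real"
  assumes frechet: "\<And>x h. (forward_diff h ^^ Suc m) f x = 0"
    and not_poly: "\<not> ordinary_polynomial f"
  obtains g :: "(real ^ 'n) \<times> real \<Rightarrow> real" and h
  where "real_polynomial_function g" "\<And>x s. (x, g (x, s)) \<in> closure (function_graph f)"
    "g (h, 1) \<noteq> g (h, 0)"
proof -
  obtain Q where Q: "real_polynomial_function Q" and Qf: "\<And>v. v \<in> rational_points \<Longrightarrow> f v = Q v"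
    using frechet_linear_polynomial[OF frechet linear_id] by auto
  obtain h where h: "f h \<noteq> Q h"
    using not_poly Q by (metis ordinary_polynomial_iff_real_polynomial_function ext)
  define L where "L = (\<lambda>v :: (real ^ 'n) \<times> real. fst v + snd v *\<^sub>R h)"
  have "linear L"
    unfolding L_def by (auto intro!: linearI simp: algebra_simps)
  then obtain P where P: "real_polynomial_function P" and Pf: "\<And>v. v \<in> rational_points \<Longrightarrow> f (L v) = P v"
    using frechet_linear_polynomial[OF frechet] by metis
  have contP: "continuous_on A P" and contQ: "continuous_on B Q" for A B
    using P Q by (auto intro!: continuous_at_imp_continuous_on continuous_real_polymonial_function)
  have P_0: "P (x, 0) = Q x" for x
  proof -
    have "closed {x. P (x, 0) = Q x}"
      by (intro closed_Collect_eq continuous_on_compose2[OF contP] contQ continuous_intros) auto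
    moreover have "rational_points \<subseteq> {x. P (x, 0) = Q x}"
    proof safe
      fix x :: "real ^ 'n" assume x: "x \<in> rational_points"
      then have "(x, 0) \<in> rational_points"
        by (auto simp: rational_points_def Basis_prod_def)
      from Pf[OF this] Qf[OF x] show "P (x, 0) = Q x"
        by (simp add: L_def)
    qed
    ultimately show ?thesis
      using closure_minimal closure_rational_points by blast
  qed
  have "(0, 1) \<in> (rational_points :: ((real ^ 'n) \<times> real) set)"
    by (auto simp: rational_points_def Basis_prod_def)
  from Pf[OF this] have P_1: "P (0, 1) = f h"
    by (simp add: L_def)
  have closure: "(L v, P v) \<in> closure (function_graph f)" for v
  proof -
    have "(\<lambda>v. (L v, P v)) ` closure rational_points \<subseteq> closure (function_graph f)"
    proof (rule image_closure_subset)
      show "continuous_on (closure rational_points) (\<lambda>v. (L v, P v))"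
        unfolding L_def by (intro continuous_intros contP)
      show "(\<lambda>v. (L v, P v)) ` rational_points \<subseteq> closure (function_graph f)"
        using Pf by (force simp: function_graph_def intro!: closure_subset[THEN subsetD])
    qed simp
    then show ?thesis
      by (auto simp: closure_rational_points)
  qed
  define g where "g = (\<lambda>z. P (fst z - snd z *\<^sub>R h, snd z))"
  have "polynomial_function (\<lambda>z :: (real ^ 'n) \<times> real. (fst z - snd z *\<^sub>R h, snd z))"
    by (intro polynomial_function_bounded_linear bounded_linear_intros)
  then have "real_polynomial_function g"
    unfolding g_def by (rule real_polynomial_function_compose'[OF P])
  moreover have "(x, g (x, s)) \<in> closure (function_graph f)" for x s
    using closure[of "(x - s *\<^sub>R h, s)"] by (simp add: g_def L_def)
  moreover have "g (h, 1) \<noteq> g (h, 0)"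
    using h by (simp add: g_def P_0 P_1)
  ultimately show thesis
    using that by blast
qed

theorem mainTheorem2:
  fixes f :: "real ^ 'n \<Rightarrow> real" and m :: nat
  assumes frechet: "\<And>x h. (forward_diff h ^^ (m + 1)) f x = 0"
    and not_poly: "\<not> ordinary_polynomial f"
  shows "(\<forall>U. open U \<and> U \<noteq> {} \<longrightarrow> \<not> bounded (f ` U)) \<and>
         (\<exists>W :: ((real ^ 'n) \<times> real) set. open W \<and> \<not> bounded W \<and> W \<subseteq> closure (function_graph f))"
proof -
  have "\<And>x h. (forward_diff h ^^ Suc m) f x = 0"
    using frechet by simp
  from this not_poly obtain g :: "(real ^ 'n) \<times> real \<Rightarrow> real" and h where g: "real_polynomial_function g"
    and graph: "\<And>x s. (x, g (x, s)) \<in> closure (function_graph f)" and gh: "g (h, 1) \<noteq> g (h, 0)"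
    by (rule frechet_closure_family) (rule that, assumption+)
  have contg: "continuous_on A g" for A
    using g by (auto intro!: continuous_at_imp_continuous_on continuous_real_polymonial_function)
  have fibre: "real_polynomial_function (\<lambda>s. g (x, s))" for x
    by (intro real_polynomial_function_compose'[OF g] polynomial_function_Pair) auto
  have slice: "real_polynomial_function (\<lambda>x. g (x, s))" for s
    by (intro real_polynomial_function_compose'[OF g] polynomial_function_Pair) auto
  have const: "g (x, 1) = g (x, 0)" if "bounded (range (\<lambda>s. g (x, s)))" for x
    using real_polynomial_function_bounded_imp_const[OF fibre that] .
  have "\<not> bounded (f ` U)" if "open U" "U \<noteq> {}" for U
  proof
    assume "bounded (f ` U)"
    then have bdd: "bounded (closure (f ` U))"
      by (rule bounded_closure)
    have "g (x, s) \<in> closure (f ` U)" if "x \<in> U" for x s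
    proof -
      have "(x, g (x, s)) \<in> (U \<times> UNIV) \<inter> closure (function_graph f)"
        using graph that by auto
      also have "\<dots> \<subseteq> closure ((U \<times> UNIV) \<inter> function_graph f)"
        by (intro open_Int_closure_subset open_Times \<open>open U\<close> open_UNIV)
      also have "\<dots> \<subseteq> closure (UNIV \<times> f ` U)"
        by (intro closure_mono) (auto simp: function_graph_def)
      finally show ?thesis
        by (simp add: closure_Times)
    qed
    then have zero: "g (x, 1) - g (x, 0) = 0" if "x \<in> U" for x
      using that const[OF bounded_subset[OF bdd]] by (simp add: image_subset_iff)
    obtain u where u: "u \<in> U"
      using \<open>U \<noteq> {}\<close> by blast
    have "real_polynomial_function (\<lambda>x. g (x, 1) - g (x, 0))"
      by (intro real_polynomial_function_diff slice)
    from real_polynomial_function_zero_on_open[OF this \<open>open U\<close> u zero]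
    have "g (h, 1) - g (h, 0) = 0" .
    with gh show False
      by simp
  qed
  moreover have "\<exists>W. open W \<and> \<not> bounded W \<and> W \<subseteq> closure (function_graph f)"
  proof -
    define W where "W = (\<Union>s t. {z. g (fst z, s) < snd z \<and> snd z < g (fst z, t)})"
    have "open W"
      unfolding W_def
      by (intro open_UN ballI open_Collect_conj open_Collect_less continuous_on_compose2[OF contg] continuous_intros) auto
    moreover have "W \<subseteq> closure (function_graph f)"
    proof
      fix z assume "z \<in> W"
      then obtain s t where "g (fst z, s) < snd z" "snd z < g (fst z, t)"
        by (auto simp: W_def)
      moreover have "connected (range (\<lambda>s. g (fst z, s)))"
        by (intro connected_continuous_image continuous_on_compose2[OF contg] continuous_intros) auto
      ultimately have "snd z \<in> range (\<lambda>s. g (fst z, s))"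
        by (blast intro: connectedD_interval[OF _ rangeI rangeI] less_imp_le)
      then obtain r where "snd z = g (fst z, r)"
        by blast
      then have "z = (fst z, g (fst z, r))"
        by (simp add: prod_eq_iff)
      then show "z \<in> closure (function_graph f)"
        using graph by metis
    qed
    moreover have "\<not> bounded W"
    proof
      assume "bounded W"
      then obtain B where B: "\<And>z. z \<in> W \<Longrightarrow> norm z \<le> B"
        by (auto simp: bounded_iff)
      (* The midpoint of g (h, s) and g (h, 0) lies in the fibre of W over h. *)
      have "norm (g (h, s)) \<le> norm (g (h, 0)) + 2 * \<bar>B\<bar>" for s
      proof (cases "g (h, s) = g (h, 0)")
        case False
        define y where "y = (g (h, s) + g (h, 0)) / 2"
        have "(h, y) \<in> W"
        proof (cases "g (h, s) < g (h, 0)")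
          case True
          then have "g (h, s) < y" "y < g (h, 0)"
            by (simp_all add: y_def)
          then show ?thesis
            by (auto simp only: W_def fst_conv snd_conv UN_iff mem_Collect_eq)
        next
          case 2: False
          with False have "g (h, 0) < y" "y < g (h, s)"
            by (simp_all add: y_def)
          then show ?thesis
            by (auto simp only: W_def fst_conv snd_conv UN_iff mem_Collect_eq)
        qed
        from B[OF this] have "\<bar>y\<bar> \<le> B"
          using norm_snd_le[of y h] by simp
        moreover have "g (h, s) = 2 * y - g (h, 0)"
          by (simp add: y_def field_simps)
        ultimately show ?thesis
          by (simp add: abs_le_iff) linarith
      qed simp
      then have "bounded (range (\<lambda>s. g (h, s)))"
        unfolding bounded_iff by blast
      with const gh show False
        by blast
    qed
    ultimately show ?thesis
      by blast
  qed
  ultimately show ?thesis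
    by blast
qed

end
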